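(* Let $G=(V,E)$ be a finite graph, $A$ its adjacency operator, $\lambda_1>\lambda_2>\cdots>\lambda_s$ the distinct eigenvalues of $A$, and $\ell^2(V)=\bigoplus_{j=1}^s E_j$ the orthogonal decomposition of $\ell^2(V)$ into eigenspaces $E_j=\ker(\lambda_j-A)$ of $A$. For a vertex $v\in V$, the following properties are equivalent: (i) $v$ is a dominant vertex; (ii) the minimal polynomial of $(A,\delta_v)$ is equal to the minimal polynomial $\prod_{j=1}^s(T-\lambda_j)$ of $A$; (iii) the vectors $\delta_v, A\delta_v, A^2\delta_v,\dots,A^{s-1}\delta_v$ in $\ell^2(V)$ are linearly independent; (iv) the orthogonal projection of $\delta_v$ on $E_j$ is not zero for all $j=1,\dots,s$ (i.e. $c_j^2>0$ for all $j$, where $c_j$ is the norm of the orthogonal projection of $\delta_v$ on $E_j$); (v) $\mu_v(\{\lambda\})>0$ for every eigenvalue $\lambda$ of $A$.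
   Context: A finite graph $G=(V,E)$ has a finite nonempty vertex set $V$ and a set $E$ of unordered pairs of distinct vertices. The adjacency operator $A$ is the self-adjoint operator on $\ell^2(V)=\mathbf{C}^V$ given by $(A\xi)(v)=\sum_{w:\{v,w\}\in E}\xi(w)$; $\delta_v$ is the characteristic function of $\{v\}$. The minimal polynomial of $(A,\xi)$, for $\xi\in\ell^2(V)$, is the monic polynomial $P_\xi\in\mathbf{C}[T]$ generating the ideal $\{Q\in\mathbf{C}[T]: Q(A)\xi=0\}$. The local spectral measure $\mu_\xi$ of $A$ at $\xi$ is the positive measure on the spectrum $\Sigma(A)$ with $\int f\,d\mu_\xi=\langle f(A)\xi\mid\xi\rangle$ for all functions $f:\Sigma(A)\to\mathbf{C}$; $\mu_v:=\mu_{\delta_v}$. A vertex $v$ is dominant if for every $\eta\in\ell^2(V)$ the measure $\mu_\eta$ is absolutely continuous with respect to $\mu_v$. *)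

theory Defs
  imports "HOL-Analysis.Analysis" "HOL-Computational_Algebra.Polynomial"
begin

text \<open>
  The vertex set of a finite graph is the universe of a finite type \<open>'v\<close>, an edge set is a set of
  two-element subsets of it, and \<open>\<ell>\<^sup>2(V)\<close> is \<^typ>\<open>complex ^ 'v\<close>, with \<open>axis v 1\<close> as \<open>\<delta>\<^sub>v\<close>.
\<close>

definition simple_graph :: "'v set set \<Rightarrow> bool" where
  "simple_graph E \<longleftrightarrow> (\<forall>e\<in>E. \<exists>u w. u \<noteq> w \<and> e = {u, w})"

definition adjacency_op :: "'v set set \<Rightarrow> complex ^ 'v \<Rightarrow> complex ^ 'v::finite" where
  "adjacency_op E \<xi> = (\<chi> v. \<Sum>w | {v, w} \<in> E. \<xi> $ w)"

text \<open>
  The library's \<open>\<bullet>\<close> on \<^typ>\<open>complex ^ 'v\<close> is only the real part of the Hermitian inner product.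
\<close>

definition herm_inner :: "complex ^ 'v \<Rightarrow> complex ^ 'v::finite \<Rightarrow> complex" where
  "herm_inner \<xi> \<eta> = (\<Sum>v\<in>UNIV. \<xi> $ v * cnj (\<eta> $ v))"

definition orth_proj :: "(complex ^ 'v) set \<Rightarrow> complex ^ 'v \<Rightarrow> complex ^ 'v::finite" where
  "orth_proj S \<xi> = (THE p. p \<in> S \<and> (\<forall>w\<in>S. herm_inner (\<xi> - p) w = 0))"

definition eigenspace :: "(complex ^ 'v \<Rightarrow> complex ^ 'v) \<Rightarrow> complex \<Rightarrow> (complex ^ 'v::finite) set" where
  "eigenspace A z = {\<xi>. z *s \<xi> - A \<xi> = 0}"

definition is_eigenvalue :: "(complex ^ 'v \<Rightarrow> complex ^ 'v::finite) \<Rightarrow> complex \<Rightarrow> bool" where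
  "is_eigenvalue A z \<longleftrightarrow> (\<exists>\<xi>. \<xi> \<noteq> 0 \<and> A \<xi> = z *s \<xi>)"

definition op_spectrum :: "(complex ^ 'v \<Rightarrow> complex ^ 'v::finite) \<Rightarrow> complex set" where
  "op_spectrum A = {z. \<not> bij (\<lambda>\<xi>. z *s \<xi> - A \<xi>)}"

text \<open>\<open>poly_op A Q\<close> is the operator \<open>Q(A)\<close>.\<close>

definition poly_op ::
    "(complex ^ 'v \<Rightarrow> complex ^ 'v) \<Rightarrow> complex poly \<Rightarrow> complex ^ 'v \<Rightarrow> complex ^ 'v::finite" where
  "poly_op A Q \<xi> = (\<Sum>i\<le>degree Q. coeff Q i *s (A ^^ i) \<xi>)"

definition vec_minpoly :: "(complex ^ 'v \<Rightarrow> complex ^ 'v) \<Rightarrow> complex ^ 'v::finite \<Rightarrow> complex poly" where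
  "vec_minpoly A \<xi> = (THE P. lead_coeff P = 1 \<and> {Q. poly_op A Q \<xi> = 0} = {Q. P dvd Q})"

definition op_minpoly :: "(complex ^ 'v \<Rightarrow> complex ^ 'v::finite) \<Rightarrow> complex poly" where
  "op_minpoly A = (THE P. lead_coeff P = 1 \<and> {Q. \<forall>\<xi>. poly_op A Q \<xi> = 0} = {Q. P dvd Q})"

text \<open>
  The functional calculus of a self-adjoint operator: \<open>f(A) = \<Sum>\<^sub>z f(z) P\<^sub>z\<close>, where \<open>z\<close> ranges over
  the spectrum and \<open>P\<^sub>z\<close> is the orthogonal projection onto the eigenspace of \<open>z\<close>.
\<close>

definition fun_op ::
    "(complex ^ 'v \<Rightarrow> complex ^ 'v) \<Rightarrow> (complex \<Rightarrow> complex) \<Rightarrow> complex ^ 'v \<Rightarrow> complex ^ 'v::finite" where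
  "fun_op A f \<xi> = (\<Sum>z\<in>op_spectrum A. f z *s orth_proj (eigenspace A z) \<xi>)"

text \<open>
  Finiteness of the measure has to be required explicitly: Bochner integrals of non-integrable
  functions are \<open>0\<close>, so an atom of infinite mass would otherwise be indistinguishable from a null set.
\<close>

definition local_spectral_measure ::
    "(complex ^ 'v \<Rightarrow> complex ^ 'v) \<Rightarrow> complex ^ 'v::finite \<Rightarrow> complex measure" where
  "local_spectral_measure A \<xi> = (THE M. finite_measure M \<and>
     space M = op_spectrum A \<and> sets M = Pow (op_spectrum A) \<and>
     (\<forall>f :: complex \<Rightarrow> complex. integral\<^sup>L M f = herm_inner (fun_op A f \<xi>) \<xi>))"

definition dominant :: "'v set set \<Rightarrow> 'v::finite \<Rightarrow> bool" where
  "dominant E v \<longleftrightarrow> (\<forall>\<eta>.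
     absolutely_continuous (local_spectral_measure (adjacency_op E) (axis v 1))
       (local_spectral_measure (adjacency_op E) \<eta>))"


subsection \<open>Well-definedness\<close>

abbreviation clin :: "(complex ^ 'v \<Rightarrow> complex ^ 'v::finite) \<Rightarrow> bool" where
  "clin A \<equiv> Vector_Spaces.linear (*s) (*s) A"

lemma clin_iff: "clin A \<longleftrightarrow> (\<forall>x y. A (x + y) = A x + A y) \<and> (\<forall>c x. A (c *s x) = c *s A x)"
  by (auto simp: Vector_Spaces.linear_iff intro: vec.vector_space_axioms)

lemma clin_adjacency_op: "clin (adjacency_op E)"
  by (auto simp: clin_iff adjacency_op_def vec_eq_iff sum.distrib sum_distrib_left)

lemma clin_shift: "clin A \<Longrightarrow> clin (\<lambda>\<xi>. z *s \<xi> - A \<xi>)"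
  by (intro vec.linear_compose_sub vec.linear_scale_self) auto

lemma op_spectrum_eq:
  assumes "clin A"
  shows "op_spectrum A = {z. is_eigenvalue A z}"
proof -
  have "bij (\<lambda>\<xi>. z *s \<xi> - A \<xi>) \<longleftrightarrow> \<not> is_eigenvalue A z" for z
  proof -
    have l: "clin (\<lambda>\<xi>. z *s \<xi> - A \<xi>)" using assms by (rule clin_shift)
    have "bij (\<lambda>\<xi>. z *s \<xi> - A \<xi>) \<longleftrightarrow> inj (\<lambda>\<xi>. z *s \<xi> - A \<xi>)"
      using vec.linear_inj_imp_surj[OF l] by (auto simp: bij_def)
    also have "\<dots> \<longleftrightarrow> \<not> is_eigenvalue A z"
      unfolding vec.linear_inj_iff_eq_0[OF l] is_eigenvalue_def by auto
    finally show ?thesis .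
  qed
  thus ?thesis by (auto simp: op_spectrum_def)
qed

lemma subspace_eigenspace:
  assumes "clin A"
  shows "vec.subspace (eigenspace A z)"
  unfolding eigenspace_def using vec.linear_subspace_kernel[OF clin_shift[OF assms]] by simp

lemma herm_inner_zero [simp]: "herm_inner 0 x = 0" "herm_inner x 0 = 0"
  and herm_inner_add: "herm_inner (x + y) w = herm_inner x w + herm_inner y w"
  and herm_inner_diff: "herm_inner (x - y) w = herm_inner x w - herm_inner y w"
  and herm_inner_scale: "herm_inner (c *s x) w = c * herm_inner x w"
  and herm_inner_scale_right: "herm_inner x (c *s w) = cnj c * herm_inner x w"
  by (simp_all add: herm_inner_def sum.distrib sum_subtractf sum_distrib_left algebra_simps)

lemma Re_herm_inner: "Re (herm_inner x y) = x \<bullet> y"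
  by (simp add: herm_inner_def inner_vec_def inner_complex_def)

lemma herm_inner_self: "herm_inner x x = of_real ((norm x)\<^sup>2)"
proof -
  have "herm_inner x x = of_real (\<Sum>v\<in>UNIV. (norm (x $ v))\<^sup>2)"
    by (simp add: herm_inner_def complex_norm_square flip: of_real_power)
  also have "(\<Sum>v\<in>UNIV. (norm (x $ v))\<^sup>2) = (norm x)\<^sup>2"
    by (simp add: norm_vec_def L2_set_def sum_nonneg)
  finally show ?thesis .
qed

lemma orth_proj_unique:
  assumes S: "vec.subspace S"
  shows "\<exists>!p. p \<in> S \<and> (\<forall>w\<in>S. herm_inner (\<xi> - p) w = 0)"
proof (rule ex_ex1I)
  have "r *\<^sub>R x = complex_of_real r *s x" for r and x :: "complex ^ 'a"
    by (simp add: vec_eq_iff scaleR_conv_of_real[where 'a = complex])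
  hence "subspace S" using S by (auto simp: subspace_def vec.subspace_def)
  then obtain p z where p: "p \<in> S" "\<And>w. w \<in> S \<Longrightarrow> orthogonal z w" "\<xi> = p + z"
    using orthogonal_subspace_decomp_exists[of S \<xi>] by (metis span_eq_iff)
  have "herm_inner z w = 0" if "w \<in> S" for w
  proof (rule complex_eqI)
    have Re0: "Re (herm_inner z u) = 0" if "u \<in> S" for u
      using p(2)[OF that] by (simp add: orthogonal_def Re_herm_inner)
    show "Re (herm_inner z w) = Re 0" using Re0[OF that] by simp
    have "\<i> *s w \<in> S" using S that by (auto simp: vec.subspace_def)
    from Re0[OF this] show "Im (herm_inner z w) = Im 0"
      by (simp add: herm_inner_scale_right)
  qed
  with p show "\<exists>p. p \<in> S \<and> (\<forall>w\<in>S. herm_inner (\<xi> - p) w = 0)" by (intro exI[of _ p]) auto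
next
  fix p q
  assume p: "p \<in> S \<and> (\<forall>w\<in>S. herm_inner (\<xi> - p) w = 0)"
    and q: "q \<in> S \<and> (\<forall>w\<in>S. herm_inner (\<xi> - q) w = 0)"
  hence pq: "p - q \<in> S" using S by (auto intro: vec.subspace_diff)
  have "herm_inner (p - q) (p - q) = herm_inner (\<xi> - q) (p - q) - herm_inner (\<xi> - p) (p - q)"
    by (simp flip: herm_inner_diff)
  also have "\<dots> = 0" using p q pq by simp
  finally show "p = q" by (simp add: herm_inner_self)
qed

lemma orth_proj:
  assumes "vec.subspace S"
  shows "orth_proj S \<xi> \<in> S" and "w \<in> S \<Longrightarrow> herm_inner (\<xi> - orth_proj S \<xi>) w = 0"
  using theI'[OF orth_proj_unique[OF assms, of \<xi>]] by (auto simp: orth_proj_def)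

lemma poly_op_alt:
  assumes "degree Q \<le> n"
  shows "poly_op A Q \<xi> = (\<Sum>i\<le>n. coeff Q i *s (A ^^ i) \<xi>)"
  unfolding poly_op_def using assms
  by (intro sum.mono_neutral_left) (auto simp: coeff_eq_0)

lemma poly_op_0 [simp]: "poly_op A 0 \<xi> = 0"
  by (simp add: poly_op_def)

lemma poly_op_add: "poly_op A (P + Q) \<xi> = poly_op A P \<xi> + poly_op A Q \<xi>"
  by (simp add: poly_op_alt[of _ "max (degree P) (degree Q)"] degree_add_le
      vec.scale_left_distrib sum.distrib)

lemma poly_op_smult: "poly_op A (smult c P) \<xi> = c *s poly_op A P \<xi>"
  by (simp add: poly_op_alt[of _ "degree P"] degree_smult_le vec.scale_sum_right)

lemma poly_op_pCons:
  assumes "clin A"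
  shows "poly_op A (pCons a P) \<xi> = a *s \<xi> + A (poly_op A P \<xi>)"
proof -
  have "poly_op A (pCons a P) \<xi> = (\<Sum>i\<le>Suc (degree P). coeff (pCons a P) i *s (A ^^ i) \<xi>)"
    by (rule poly_op_alt) (simp add: degree_pCons_le)
  also have "\<dots> = a *s \<xi> + (\<Sum>i\<le>degree P. coeff P i *s A ((A ^^ i) \<xi>))"
    by (subst sum.atMost_Suc_shift) simp
  also have "(\<Sum>i\<le>degree P. coeff P i *s A ((A ^^ i) \<xi>)) = A (poly_op A P \<xi>)"
    by (simp add: poly_op_def vec.linear_sum[OF assms] vec.linear_scale[OF assms])
  finally show ?thesis .
qed

lemma poly_op_mult:
  assumes "clin A"
  shows "poly_op A (P * Q) \<xi> = poly_op A P (poly_op A Q \<xi>)"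
  by (induction P) (simp_all add: poly_op_add poly_op_smult poly_op_pCons[OF assms])

lemma poly_op_zero_vec: "clin A \<Longrightarrow> poly_op A P 0 = 0"
  by (induction P) (simp_all add: poly_op_pCons vec.linear_0)

lemma monic_generator:
  fixes I :: "complex poly set"
  assumes "P0 \<in> I" "P0 \<noteq> 0"
    and add: "\<And>P Q. P \<in> I \<Longrightarrow> Q \<in> I \<Longrightarrow> P + Q \<in> I"
    and mult: "\<And>P Q. P \<in> I \<Longrightarrow> Q * P \<in> I"
  shows "\<exists>!P. lead_coeff P = 1 \<and> I = {Q. P dvd Q}"
proof (rule ex_ex1I)
  obtain P where P: "P \<in> I" "P \<noteq> 0" "\<And>Q. Q \<in> I \<Longrightarrow> Q \<noteq> 0 \<Longrightarrow> degree P \<le> degree Q"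
    using ex_has_least_nat[of "\<lambda>P. P \<in> I \<and> P \<noteq> 0" P0 degree] assms(1,2) by blast
  define R where "R = smult (inverse (lead_coeff P)) P"
  have R: "R \<in> I" "lead_coeff R = 1" "degree R = degree P"
    using P mult[of P "[:inverse (lead_coeff P):]"] by (auto simp: R_def)
  have "R dvd Q" if "Q \<in> I" for Q
  proof (rule ccontr)
    assume "\<not> R dvd Q"
    hence nz: "Q mod R \<noteq> 0" by (simp add: dvd_eq_mod_eq_0)
    have "Q mod R = Q + (- (Q div R)) * R"
      by (metis add.commute add_diff_cancel_right' div_mult_mod_eq minus_mult_left uminus_add_conv_diff)
    hence "Q mod R \<in> I" using add mult that R(1) by metis
    with P(3) nz have "degree P \<le> degree (Q mod R)" by blast
    moreover have "degree (Q mod R) < degree R"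
      using degree_mod_less'[OF _ nz] R(2) by force
    ultimately show False using R(3) by simp
  qed
  moreover have "Q \<in> I" if "R dvd Q" for Q
    using that mult[OF R(1)] by (auto simp: dvd_def mult.commute)
  ultimately show "\<exists>P. lead_coeff P = 1 \<and> I = {Q. P dvd Q}"
    using R(2) by blast
next
  fix P Q
  assume PQ: "lead_coeff P = 1 \<and> I = {R. P dvd R}" "lead_coeff Q = 1 \<and> I = {R. Q dvd R}"
  have lc: "lead_coeff P = 1" "lead_coeff Q = 1" using PQ by blast+
  have "{R. P dvd R} = {R. Q dvd R}" using PQ by simp
  hence dvd: "P dvd Q" "Q dvd P" by (metis dvd_refl mem_Collect_eq)+
  from dvd(1) obtain k where k: "Q = P * k" by (rule dvdE)
  have nz: "P \<noteq> 0" "Q \<noteq> 0" using lc by auto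
  hence "degree Q \<le> degree P" using dvd(2) by (intro dvd_imp_degree_le)
  moreover have "degree Q = degree P + degree k" using nz k by (simp add: degree_mult_eq)
  ultimately have deg: "degree k = 0" by simp
  moreover have "lead_coeff k = 1" using lc k by (simp add: lead_coeff_mult)
  ultimately have "k = 1" by (auto elim: degree_eq_zeroE)
  with k show "P = Q" by simp
qed

lemma annihilator_exists:
  fixes A :: "complex ^ 'v \<Rightarrow> complex ^ 'v::finite"
  assumes "clin A"
  shows "\<exists>Q. Q \<noteq> 0 \<and> poly_op A Q \<xi> = 0"
proof (cases "inj_on (\<lambda>i. (A ^^ i) \<xi>) {..CARD('v)}")
  case True
  let ?g = "\<lambda>i. (A ^^ i) (\<xi> :: complex ^ 'v)"
  have "\<not> vec.independent (?g ` {..CARD('v)})"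
  proof
    assume "vec.independent (?g ` {..CARD('v)})"
    from vec.independent_bound_general[OF this] have "card (?g ` {..CARD('v)}) \<le> CARD('v)"
      using dim_subset_UNIV_cart_gen order_trans by blast
    thus False using card_image[OF True] by simp
  qed
  then obtain u where u: "(\<Sum>x\<in>?g ` {..CARD('v)}. u x *s x) = 0"
      "\<exists>x\<in>?g ` {..CARD('v)}. u x \<noteq> 0"
    by (auto simp: vec.dependent_finite)
  define Q where "Q = (\<Sum>i\<le>CARD('v). monom (u (?g i)) i)"
  have c: "coeff Q i = (if i \<le> CARD('v) then u (?g i) else 0)" for i
    by (simp add: Q_def coeff_sum)
  have "degree Q \<le> CARD('v)" by (rule degree_le) (simp add: c)
  hence "poly_op A Q \<xi> = (\<Sum>i\<le>CARD('v). u (?g i) *s ?g i)"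
    by (simp add: poly_op_alt c)
  also have "\<dots> = 0" using u(1) by (simp add: sum.reindex[OF True])
  finally have "poly_op A Q \<xi> = 0" .
  moreover have "Q \<noteq> 0"
  proof
    assume "Q = 0"
    with c have "(if i \<le> CARD('v) then u (?g i) else 0) = 0" for i by (metis coeff_0)
    hence "u (?g i) = 0" if "i \<le> CARD('v)" for i using that by (metis (full_types))
    thus False using u(2) by blast
  qed
  ultimately show ?thesis by blast
next
  case False
  then obtain i j where ij: "i \<noteq> j" "(A ^^ i) \<xi> = (A ^^ j) \<xi>"
    by (auto simp: inj_on_def)
  define Q :: "complex poly" where "Q = monom 1 i + monom (-1) j"
  have "poly_op A (monom a i) \<xi> = a *s (A ^^ i) \<xi>" for a i
    by (simp add: poly_op_alt[of _ i] degree_monom_le sum.delta' if_distrib[of "\<lambda>x. x *s _"] cong: if_cong)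
  hence "poly_op A Q \<xi> = 0" by (simp add: Q_def poly_op_add ij(2))
  moreover have "coeff Q i = 1" using ij(1) by (simp add: Q_def)
  hence "Q \<noteq> 0" by auto
  ultimately show ?thesis by blast
qed

lemma vec_minpoly_unique:
  assumes "clin A"
  shows "\<exists>!P. lead_coeff P = 1 \<and> {Q. poly_op A Q \<xi> = 0} = {Q. P dvd Q}"
proof -
  obtain Q where "Q \<noteq> 0" "poly_op A Q \<xi> = 0" using annihilator_exists[OF assms] by blast
  thus ?thesis
    by (intro monic_generator)
      (auto simp: poly_op_add poly_op_mult[OF assms] poly_op_zero_vec[OF assms])
qed

lemma op_annihilator_exists:
  assumes "clin A"
  shows "\<exists>Q. Q \<noteq> 0 \<and> (\<forall>\<xi>. poly_op A Q \<xi> = 0)"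
proof -
  obtain q where q: "\<And>\<xi>. q \<xi> \<noteq> 0" "\<And>\<xi>. poly_op A (q \<xi>) \<xi> = 0"
    using annihilator_exists[OF assms] by metis
  define Q where "Q = (\<Prod>b\<in>cart_basis. q b)"
  have nz: "Q \<noteq> 0" using q(1) by (simp add: Q_def finite_cart_basis)
  have lin: "clin (poly_op A Q)"
  proof -
    have "poly_op A Q (x + y) = poly_op A Q x + poly_op A Q y" for x y
      by (induction Q) (simp_all add: poly_op_pCons[OF assms] vec.linear_add[OF assms]
          vec.scale_right_distrib)
    moreover have "poly_op A Q (c *s x) = c *s poly_op A Q x" for c x
      by (induction Q) (simp_all add: poly_op_pCons[OF assms] vec.linear_scale[OF assms]
          vec.scale_right_distrib vec.scale_left_commute mult.commute)
    ultimately show ?thesis by (simp add: clin_iff)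
  qed
  have "poly_op A Q b = 0" if "b \<in> cart_basis" for b
  proof -
    have "Q = (\<Prod>b\<in>cart_basis - {b}. q b) * q b"
      unfolding Q_def using that by (subst prod.remove[of _ b]) (auto simp: finite_cart_basis mult.commute)
    thus ?thesis using q(2) by (metis poly_op_mult[OF assms] poly_op_zero_vec[OF assms])
  qed
  hence "poly_op A Q \<xi> = 0" for \<xi>
    using vec.linear_eq_0_on_span[OF lin, of cart_basis \<xi>] span_cart_basis by auto
  with nz show ?thesis by blast
qed

lemma op_minpoly_unique:
  assumes "clin A"
  shows "\<exists>!P. lead_coeff P = 1 \<and> {Q. \<forall>\<xi>. poly_op A Q \<xi> = 0} = {Q. P dvd Q}"
proof -
  obtain Q where "Q \<noteq> 0" "\<forall>\<xi>. poly_op A Q \<xi> = 0" using op_annihilator_exists[OF assms] by blast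
  thus ?thesis
    by (intro monic_generator)
      (auto simp: poly_op_add poly_op_mult[OF assms] poly_op_zero_vec[OF assms])
qed

lemma finite_op_spectrum:
  assumes "clin A"
  shows "finite (op_spectrum A)"
proof -
  obtain Q where Q: "Q \<noteq> 0" "\<forall>\<xi>. poly_op A Q \<xi> = 0"
    using op_annihilator_exists[OF assms] by blast
  have "poly Q z = 0" if z: "is_eigenvalue A z" for z
  proof -
    obtain \<xi> where x: "\<xi> \<noteq> 0" "A \<xi> = z *s \<xi>" using z by (auto simp: is_eigenvalue_def)
    have "poly_op A P \<xi> = poly P z *s \<xi>" for P
      by (induction P) (simp_all add: poly_op_pCons[OF assms] vec.linear_scale[OF assms] x(2)
          vec.scale_left_distrib mult.commute)
    thus ?thesis using Q(2) x(1) by (metis vec.scale_eq_0_iff)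
  qed
  hence "op_spectrum A \<subseteq> {z. poly Q z = 0}" by (auto simp: op_spectrum_eq[OF assms])
  thus ?thesis using poly_roots_finite[OF Q(1)] by (rule finite_subset)
qed

lemma herm_inner_sum: "herm_inner (\<Sum>i\<in>I. g i) w = (\<Sum>i\<in>I. herm_inner (g i) w)"
  by (induction I rule: infinite_finite_induct) (simp_all add: herm_inner_add)

lemma herm_inner_cnj: "herm_inner y x = cnj (herm_inner x y)"
  by (simp add: herm_inner_def cnj_sum mult.commute)

lemma herm_inner_orth_proj:
  assumes "vec.subspace S"
  shows "herm_inner (orth_proj S \<xi>) \<xi> = of_real ((norm (orth_proj S \<xi>))\<^sup>2)"
proof -
  let ?p = "orth_proj S \<xi>"
  have "herm_inner (\<xi> - ?p) ?p = 0" using orth_proj[OF assms] by blast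
  hence "herm_inner \<xi> ?p = herm_inner ?p ?p" by (simp add: herm_inner_diff)
  thus ?thesis by (metis herm_inner_cnj herm_inner_self complex_cnj_complex_of_real)
qed

lemma local_spectral_measure_unique:
  fixes A :: "complex ^ 'v \<Rightarrow> complex ^ 'v::finite"
  assumes A: "clin A"
  shows "\<exists>!M. finite_measure M \<and> space M = op_spectrum A \<and> sets M = Pow (op_spectrum A) \<and>
     (\<forall>f :: complex \<Rightarrow> complex. integral\<^sup>L M f = herm_inner (fun_op A f \<xi>) \<xi>)"
proof (rule ex_ex1I)
  let ?c = "\<lambda>z. (norm (orth_proj (eigenspace A z) \<xi>))\<^sup>2"
  let ?M = "point_measure (op_spectrum A) (\<lambda>z. ennreal (?c z))"
  have fin: "finite (op_spectrum A)" by (rule finite_op_spectrum[OF A])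
  have "finite_measure ?M"
    by (rule finite_measureI) (simp add: space_point_measure emeasure_point_measure_finite fin)
  moreover have "integral\<^sup>L ?M f = herm_inner (fun_op A f \<xi>) \<xi>" for f :: "complex \<Rightarrow> complex"
    by (simp add: lebesgue_integral_point_measure_finite fin fun_op_def herm_inner_sum
        herm_inner_scale herm_inner_orth_proj subspace_eigenspace A scaleR_conv_of_real mult.commute)
  ultimately show "\<exists>M. finite_measure M \<and> space M = op_spectrum A \<and>
      sets M = Pow (op_spectrum A) \<and>
      (\<forall>f :: complex \<Rightarrow> complex. integral\<^sup>L M f = herm_inner (fun_op A f \<xi>) \<xi>)"
    by (intro exI[of _ ?M]) (auto simp: space_point_measure sets_point_measure)
next
  fix M N
  assume M: "finite_measure M \<and> space M = op_spectrum A \<and> sets M = Pow (op_spectrum A) \<and>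
     (\<forall>f :: complex \<Rightarrow> complex. integral\<^sup>L M f = herm_inner (fun_op A f \<xi>) \<xi>)"
    and N: "finite_measure N \<and> space N = op_spectrum A \<and> sets N = Pow (op_spectrum A) \<and>
     (\<forall>f :: complex \<Rightarrow> complex. integral\<^sup>L N f = herm_inner (fun_op A f \<xi>) \<xi>)"
  show "M = N"
  proof (rule measure_eqI)
    show "sets M = sets N" using M N by simp
    fix X assume X: "X \<in> sets M"
    have "complex_of_real (measure K X) = integral\<^sup>L K (indicator X :: complex \<Rightarrow> complex)"
      if "finite_measure K" "X \<in> sets K" for K
    proof -
      have "integral\<^sup>L K (indicator X :: complex \<Rightarrow> complex) =
          integral\<^sup>L K (\<lambda>x. complex_of_real (indicator X x))"
        by (simp only: of_real_indicator)
      also have "\<dots> = complex_of_real (measure K X)"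
        using that(2) by (simp only: integral_complex_of_real
            Bochner_Integration.integral_indicator sets.Int_space_eq2)
      finally show ?thesis by simp
    qed
    hence "complex_of_real (measure M X) = complex_of_real (measure N X)"
      using M N X by metis
    thus "emeasure M X = emeasure N X"
      using M N by (simp add: finite_measure.emeasure_eq_measure)
  qed
qed

end

theory Submission
  imports Defs "HOL-Computational_Algebra.Fundamental_Theorem_Algebra"
begin

text \<open>
  A Hermitian operator decomposes \<open>\<xi>\<close> as \<open>\<Sum>\<^sub>z P\<^sub>z \<xi>\<close> over its spectrum, where the summands are
  pairwise orthogonal, so \<open>Q(A) \<xi> = \<Sum>\<^sub>z Q(z) P\<^sub>z \<xi>\<close> vanishes iff \<open>Q\<close> vanishes on the support
  \<open>{z. P\<^sub>z \<xi> \<noteq> 0}\<close>. Hence the minimal polynomial of \<open>(A, \<xi>)\<close> is the product of \<open>T - z\<close> over the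
  support, and the local spectral measure has mass \<open>\<parallel>P\<^sub>z \<xi>\<parallel>\<^sup>2\<close> at \<open>z\<close>. All five conditions say that
  the support of \<open>\<delta>\<^sub>v\<close> is the whole spectrum; for the dominance of \<open>v\<close>, test against an eigenvector.
\<close>

section \<open>Products of distinct linear factors\<close>

text \<open>Induction splits off one root at a time: if \<open>Q = [:- z, 1:] * R\<close>, the
  factor cancels in the divisibility, and at every point other than \<open>z\<close> it is nonzero,
  so \<open>Q\<close> and \<open>R\<close> have the same zeros on the remaining set.\<close>

lemma prod_linear_dvd_iff:
  fixes Q :: "'a::idom poly"
  assumes "finite S"
  shows "(\<Prod>z\<in>S. [:- z, 1:]) dvd Q \<longleftrightarrow> (\<forall>z\<in>S. poly Q z = 0)"
  using assms
proof (induction S arbitrary: Q)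
  case empty
  then show ?case by simp
next
  case (insert z S)
  show ?case
  proof (cases "poly Q z = 0")
    case True
    then obtain R where R: "Q = [:- z, 1:] * R" by (auto simp: poly_eq_0_iff_dvd)
    have "(\<Prod>w\<in>insert z S. [:- w, 1:]) dvd Q \<longleftrightarrow> (\<Prod>w\<in>S. [:- w, 1:]) dvd R"
      using insert.hyps unfolding R by (simp del: mult_pCons_left)
    also have "\<dots> \<longleftrightarrow> (\<forall>w\<in>S. poly R w = 0)" by (rule insert.IH)
    also have "\<dots> \<longleftrightarrow> (\<forall>w\<in>insert z S. poly Q w = 0)"
      using insert.hyps unfolding R by auto
    finally show ?thesis .
  next
    case False
    have "[:- z, 1:] dvd (\<Prod>w\<in>insert z S. [:- w, 1:])"
      using insert.hyps by (simp del: mult_pCons_left)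
    with False show ?thesis using dvd_trans poly_eq_0_iff_dvd by blast
  qed
qed

lemma monic_prod_linear: "lead_coeff (\<Prod>z\<in>S. [:- z, 1:]) = (1 :: 'a::idom)"
  by (simp add: lead_coeff_prod)

lemma degree_prod_linear: "degree (\<Prod>z\<in>S. [:- z, 1 :: 'a::idom:]) = card S"
  by (subst degree_prod_sum_eq) auto

lemma poly_prod_linear_eq_0_iff:
  "finite S \<Longrightarrow> poly (\<Prod>z\<in>S. [:- z, 1:]) w = 0 \<longleftrightarrow> w \<in> (S :: 'a::idom set)"
  by (auto simp: poly_prod)

section \<open>Linear independence of Krylov vectors\<close>

text \<open>\<open>vec.independent\<close> concerns a set and cannot see repeated vectors; adding
  injectivity yields independence of the indexed family.\<close>

lemma independent_family_iff:
  fixes g :: "nat \<Rightarrow> 'a::field ^ 'n"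
  shows "inj_on g {..<n} \<and> vec.independent (g ` {..<n}) \<longleftrightarrow>
    (\<forall>u. (\<Sum>i<n. u i *s g i) = 0 \<longrightarrow> (\<forall>i<n. u i = 0))"
proof (intro iffI conjI allI impI)
  fix u i
  assume *: "inj_on g {..<n} \<and> vec.independent (g ` {..<n})"
    and u: "(\<Sum>i<n. u i *s g i) = 0" and i: "i < n"
  \<comment> \<open>Inverting \<open>g\<close> on the index range turns coefficients indexed by
    numbers into coefficients indexed by vectors.\<close>
  let ?u = "\<lambda>x. u (inv_into {..<n} g x)"
  have indep: "\<forall>w. (\<Sum>x\<in>g ` {..<n}. w x *s x) = 0 \<longrightarrow> (\<forall>x\<in>g ` {..<n}. w x = 0)"
    using * by (simp only: vec.dependent_finite finite_imageI finite_lessThan) metis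
  have "(\<Sum>x\<in>g ` {..<n}. ?u x *s x) = 0"
    using * u by (simp add: sum.reindex)
  hence "\<forall>x\<in>g ` {..<n}. ?u x = 0" by (rule indep[THEN spec[of _ ?u], THEN mp])
  hence "?u (g i) = 0" using i by simp
  thus "u i = 0" using * i by simp
next
  assume *: "\<forall>u. (\<Sum>i<n. u i *s g i) = 0 \<longrightarrow> (\<forall>i<n. u i = 0)"
  show inj: "inj_on g {..<n}"
  proof (rule inj_onI, rule ccontr)
    fix i j assume ij: "i \<in> {..<n}" "j \<in> {..<n}" "g i = g j" "i \<noteq> j"
    \<comment> \<open>If \<open>g i = g j\<close>, then \<open>g i - g j = 0\<close> is a nontrivial
      relation; these are its coefficients.\<close>
    let ?u = "\<lambda>k. (if k = i then 1 else 0) - (if k = j then 1 else 0) :: 'a"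
    have "(\<Sum>k<n. ?u k *s g k) = 0"
      using ij by (simp add: vec.scale_left_diff_distrib sum_subtractf if_distrib[of "\<lambda>c. c *s _"]
          cong: if_cong)
    hence "\<forall>k<n. ?u k = 0" by (rule *[THEN spec[of _ ?u], THEN mp])
    hence "?u i = 0" using ij(1) by blast
    with ij(4) show False by simp
  qed
  show "vec.independent (g ` {..<n})"
  proof -
    have "u x = 0" if "(\<Sum>x\<in>g ` {..<n}. u x *s x) = 0" "x \<in> g ` {..<n}" for u x
      using *[rule_format, of "\<lambda>i. u (g i)"] that by (auto simp: sum.reindex[OF inj])
    thus ?thesis by (auto simp: vec.dependent_finite)
  qed
qed

text \<open>A relation among the first \<open>n\<close> Krylov vectors is a polynomial of degree
  below \<open>n\<close> that annihilates \<open>\<xi>\<close>, with the same coefficients.\<close>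

lemma krylov_independent_iff:
  "inj_on (\<lambda>i. (A ^^ i) \<xi>) {..<n} \<and> vec.independent ((\<lambda>i. (A ^^ i) \<xi>) ` {..<n}) \<longleftrightarrow>
    (\<forall>Q. Q \<noteq> 0 \<and> poly_op A Q \<xi> = 0 \<longrightarrow> n \<le> degree Q)"
  unfolding independent_family_iff
proof (intro iffI allI impI)
  fix Q assume *: "\<forall>u. (\<Sum>i<n. u i *s (A ^^ i) \<xi>) = 0 \<longrightarrow> (\<forall>i<n. u i = 0)"
    and Q: "Q \<noteq> 0 \<and> poly_op A Q \<xi> = 0"
  show "n \<le> degree Q"
  proof (rule ccontr)
    assume "\<not> n \<le> degree Q"
    hence n: "degree Q < n" by simp
    have "(\<Sum>i<n. coeff Q i *s (A ^^ i) \<xi>) = poly_op A Q \<xi>"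
      unfolding poly_op_def using n by (intro sum.mono_neutral_right) (auto simp: coeff_eq_0)
    with * Q n have "lead_coeff Q = 0" by metis
    with Q show False by simp
  qed
next
  fix u i assume *: "\<forall>Q. Q \<noteq> 0 \<and> poly_op A Q \<xi> = 0 \<longrightarrow> n \<le> degree Q"
    and u: "(\<Sum>i<n. u i *s (A ^^ i) \<xi>) = 0" and i: "i < n"
  define Q where "Q = (\<Sum>i<n. monom (u i) i)"
  have c: "coeff Q k = (if k < n then u k else 0)" for k
    by (simp add: Q_def coeff_sum)
  \<comment> \<open>Here \<open>i < n\<close> supplies \<open>n > 0\<close>: the zero polynomial has
    degree 0, so the strict bound would fail for \<open>n = 0\<close>.\<close>
  have n: "degree Q < n" using i by (intro degree_lessI) (auto simp: c)
  have "poly_op A Q \<xi> = (\<Sum>i<n. coeff Q i *s (A ^^ i) \<xi>)"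
    unfolding poly_op_def using n by (intro sum.mono_neutral_left) (auto simp: coeff_eq_0)
  also have "\<dots> = 0" using u by (simp add: c)
  finally have "Q = 0" using * n by force
  thus "u i = 0" using c[of i] i by simp
qed

section \<open>Polynomials in an operator and minimal polynomials\<close>

lemma poly_op_sum_vec:
  assumes "clin A"
  shows "poly_op A Q (\<Sum>i\<in>I. g i) = (\<Sum>i\<in>I. poly_op A Q (g i))"
proof (induction Q)
  case (pCons a Q)
  then show ?case
    by (simp add: poly_op_pCons[OF assms] vec.linear_sum[OF assms] vec.scale_sum_right sum.distrib)
qed simp

lemma poly_op_eigenvector:
  assumes "clin A" "A x = z *s x"
  shows "poly_op A Q x = poly Q z *s x"
  by (induction Q) (simp_all add: poly_op_pCons assms vec.linear_scale[OF assms(1)]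
      vec.scale_left_distrib mult.commute)

lemma mem_eigenspace_iff: "x \<in> eigenspace A z \<longleftrightarrow> A x = z *s x"
  by (auto simp: eigenspace_def)

lemma vec_minpoly_eqI:
  assumes "clin A" "lead_coeff P = 1" "\<And>Q. poly_op A Q \<xi> = 0 \<longleftrightarrow> P dvd Q"
  shows "vec_minpoly A \<xi> = P"
  unfolding vec_minpoly_def
  by (rule the1_equality[OF vec_minpoly_unique[OF assms(1)]]) (use assms in auto)

lemma op_minpoly_eqI:
  assumes "clin A" "lead_coeff P = 1" "\<And>Q. (\<forall>\<xi>. poly_op A Q \<xi> = 0) \<longleftrightarrow> P dvd Q"
  shows "op_minpoly A = P"
  unfolding op_minpoly_def
  by (rule the1_equality[OF op_minpoly_unique[OF assms(1)]]) (use assms in auto)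

lemma vec_minpoly:
  assumes "clin A"
  shows "lead_coeff (vec_minpoly A \<xi>) = 1" "poly_op A Q \<xi> = 0 \<longleftrightarrow> vec_minpoly A \<xi> dvd Q"
  using theI'[OF vec_minpoly_unique[OF assms, of \<xi>]] unfolding vec_minpoly_def[symmetric] by auto

text \<open>The annihilators of \<open>\<xi>\<close> are the multiples of its minimal polynomial,
  which therefore has the least degree among the nonzero ones.\<close>

lemma krylov_independent_iff_degree:
  assumes "clin A"
  shows "inj_on (\<lambda>i. (A ^^ i) \<xi>) {..<n} \<and> vec.independent ((\<lambda>i. (A ^^ i) \<xi>) ` {..<n}) \<longleftrightarrow>
    n \<le> degree (vec_minpoly A \<xi>)"
proof -
  let ?P = "vec_minpoly A \<xi>"
  have "?P \<noteq> 0" using vec_minpoly(1)[OF assms, of \<xi>] by auto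
  hence "(\<forall>Q. Q \<noteq> 0 \<and> ?P dvd Q \<longrightarrow> n \<le> degree Q) \<longleftrightarrow> n \<le> degree ?P"
    by (metis dvd_imp_degree_le dvd_refl order_trans)
  thus ?thesis by (simp only: krylov_independent_iff vec_minpoly(2)[OF assms])
qed

section \<open>Local spectral measures and their null sets\<close>

text \<open>By uniqueness it suffices that the point measure satisfies the defining property; its
  integrals are right because pairing the projection of \<open>\<xi>\<close> with
  \<open>\<xi>\<close> gives the squared norm of the projection.\<close>

lemma local_spectral_measure_eq:
  assumes A: "clin A"
  shows "local_spectral_measure A \<xi> =
    point_measure (op_spectrum A) (\<lambda>z. ennreal ((norm (orth_proj (eigenspace A z) \<xi>))\<^sup>2))"
    (is "_ = ?M")
  unfolding local_spectral_measure_def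
proof (rule the1_equality[OF local_spectral_measure_unique[OF A]], intro conjI allI)
  have fin: "finite (op_spectrum A)" by (rule finite_op_spectrum[OF A])
  show "finite_measure ?M"
    by (rule finite_measureI) (simp add: space_point_measure emeasure_point_measure_finite fin)
  show "integral\<^sup>L ?M f = herm_inner (fun_op A f \<xi>) \<xi>" for f :: "complex \<Rightarrow> complex"
    by (simp add: lebesgue_integral_point_measure_finite fin fun_op_def herm_inner_sum
        herm_inner_scale herm_inner_orth_proj subspace_eigenspace A scaleR_conv_of_real mult.commute)
qed (simp_all add: space_point_measure sets_point_measure)

lemma measure_local_spectral_measure_singleton:
  assumes "clin A" "z \<in> op_spectrum A"
  shows "measure (local_spectral_measure A \<xi>) {z} = (norm (orth_proj (eigenspace A z) \<xi>))\<^sup>2"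
  using assms finite_op_spectrum[of A]
  by (simp add: local_spectral_measure_eq measure_def emeasure_point_measure_finite)

lemma null_sets_local_spectral_measure:
  assumes "clin A"
  shows "null_sets (local_spectral_measure A \<xi>) =
    Pow {z \<in> op_spectrum A. orth_proj (eigenspace A z) \<xi> = 0}"
proof -
  note fin = finite_op_spectrum[OF assms]
  have "X \<in> null_sets (local_spectral_measure A \<xi>) \<longleftrightarrow>
      X \<subseteq> op_spectrum A \<and> (\<forall>z\<in>X. orth_proj (eigenspace A z) \<xi> = 0)" for X
    using fin
    by (auto simp: null_sets_def local_spectral_measure_eq[OF assms] sets_point_measure
        emeasure_point_measure_finite finite_subset[OF _ fin] sum_nonneg_eq_0_iff
        simp del: sum_ennreal)
  thus ?thesis by auto
qed

lemma orth_proj_eqI: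
  assumes "vec.subspace S" "p \<in> S" "\<And>w. w \<in> S \<Longrightarrow> herm_inner (\<xi> - p) w = 0"
  shows "orth_proj S \<xi> = p"
  unfolding orth_proj_def by (rule the1_equality[OF orth_proj_unique[OF assms(1)]]) (use assms in auto)

lemma orth_proj_self: "vec.subspace S \<Longrightarrow> \<xi> \<in> S \<Longrightarrow> orth_proj S \<xi> = \<xi>"
  by (rule orth_proj_eqI) auto

text \<open>An eigenvector at \<open>z\<close> is its own projection, so \<open>{z}\<close> is not
  null for its measure and cannot be null for that of \<open>\<xi>\<close>. Conversely, if no
  projection of \<open>\<xi>\<close> vanishes, only the empty set is null for its measure.\<close>

lemma absolutely_continuous_local_spectral_measure_iff:
  assumes "clin A"
  shows "(\<forall>\<eta>. absolutely_continuous (local_spectral_measure A \<xi>) (local_spectral_measure A \<eta>)) \<longleftrightarrow>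
    (\<forall>z\<in>op_spectrum A. orth_proj (eigenspace A z) \<xi> \<noteq> 0)"
proof (intro iffI ballI allI)
  fix z assume *: "\<forall>\<eta>. absolutely_continuous (local_spectral_measure A \<xi>) (local_spectral_measure A \<eta>)"
    and z: "z \<in> op_spectrum A"
  from z obtain \<eta> where \<eta>: "\<eta> \<noteq> 0" "A \<eta> = z *s \<eta>"
    by (auto simp: op_spectrum_eq[OF assms] is_eigenvalue_def)
  hence "orth_proj (eigenspace A z) \<eta> \<noteq> 0"
    by (simp add: orth_proj_self subspace_eigenspace assms mem_eigenspace_iff)
  hence "{z} \<notin> null_sets (local_spectral_measure A \<eta>)"
    by (simp add: null_sets_local_spectral_measure assms)
  with * have "{z} \<notin> null_sets (local_spectral_measure A \<xi>)"
    by (auto simp: absolutely_continuous_def)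
  with z show "orth_proj (eigenspace A z) \<xi> \<noteq> 0"
    by (simp add: null_sets_local_spectral_measure assms)
qed (auto simp: absolutely_continuous_def null_sets_local_spectral_measure assms)

section \<open>Spectral decomposition of a Hermitian operator\<close>

locale hermitian_op =
  fixes A :: "complex ^ 'v \<Rightarrow> complex ^ 'v::finite"
  assumes clin: "clin A"
    and selfadj: "herm_inner (A x) y = herm_inner x (A y)"
begin

abbreviation proj :: "complex \<Rightarrow> complex ^ 'v \<Rightarrow> complex ^ 'v" where
  "proj z \<equiv> orth_proj (eigenspace A z)"

lemma proj_eigen: "A (proj z \<xi>) = z *s proj z \<xi>"
  using orth_proj(1)[OF subspace_eigenspace[OF clin]] by (simp add: mem_eigenspace_iff)

lemma eigenvalue_real:
  assumes "A x = z *s x" "x \<noteq> 0"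
  shows "cnj z = z"
proof -
  have "z * herm_inner x x = cnj z * herm_inner x x"
    using selfadj[of x x] by (simp add: assms herm_inner_scale herm_inner_scale_right)
  moreover have "herm_inner x x \<noteq> 0" using assms by (simp add: herm_inner_self)
  ultimately show ?thesis by simp
qed

lemma eigenvectors_orthogonal:
  assumes "A x = z *s x" "A y = w *s y" "z \<noteq> w"
  shows "herm_inner x y = 0"
\<comment> \<open>Moving \<open>A\<close> to the second argument produces \<open>cnj w\<close>, and
  \<open>w\<close> is known to be real only when \<open>y\<close> is nonzero.\<close>
proof (cases "y = 0")
  case False
  have "z * herm_inner x y = w * herm_inner x y"
    using selfadj[of x y] eigenvalue_real[OF assms(2) False]
    by (simp add: assms herm_inner_scale herm_inner_scale_right)
  with assms(3) show ?thesis by simp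
qed simp

text \<open>The orthogonal complement of an eigenvector is invariant under \<open>A\<close>, hence
  under every polynomial in \<open>A\<close>.\<close>

lemma poly_op_selfadj_eigen:
  assumes "A w = z *s w" "herm_inner x w = 0"
  shows "herm_inner (poly_op A Q x) w = 0"
proof (induction Q)
  case (pCons a Q)
  then show ?case
    using assms
    by (simp add: poly_op_pCons[OF clin] herm_inner_add herm_inner_scale selfadj
        herm_inner_scale_right)
qed simp

text \<open>For \<open>x\<close> nonzero, a complex root \<open>z\<close> of its minimal polynomial
  leaves a cofactor \<open>R\<close> such that \<open>R(A) x\<close> satisfies the eigenvector
  equation at \<open>z\<close>. So \<open>x\<close> is orthogonal to it, and by invariance so is
  \<open>R(A) x\<close> itself. Thus \<open>R(A) x = 0\<close>, although \<open>R\<close> has degree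
  below the minimal one.\<close>

lemma orthogonal_to_eigenvectors_eq_0:
  assumes "\<And>z w. A w = z *s w \<Longrightarrow> herm_inner x w = 0"
  shows "x = 0"
proof (rule ccontr)
  assume x: "x \<noteq> 0"
  let ?P = "vec_minpoly A x"
  have P: "?P \<noteq> 0" using vec_minpoly(1)[OF clin, of x] by auto
  have "degree ?P \<noteq> 0"
  proof
    assume "degree ?P = 0"
    then obtain a where a: "?P = [:a:]" by (rule degree_eq_zeroE)
    hence "poly_op A [:a:] x = 0" using vec_minpoly(2)[OF clin] by auto
    hence "a *s x = 0" by (simp add: poly_op_pCons[OF clin] vec.linear_0[OF clin])
    with x P a show False by simp
  qed
  then obtain z where "poly ?P z = 0"
    using fundamental_theorem_of_algebra constant_degree by metis
  then obtain R where R: "?P = [:- z, 1:] * R" by (auto simp: poly_eq_0_iff_dvd)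
  let ?y = "poly_op A R x"
  have "poly_op A ([:- z, 1:] * R) x = 0" using vec_minpoly(2)[OF clin, of ?P x] R by simp
  hence y: "A ?y = z *s ?y"
    by (simp del: mult_pCons_left add: poly_op_mult[OF clin] poly_op_pCons[OF clin] vec.linear_0[OF clin])
  have "herm_inner ?y ?y = 0" by (rule poly_op_selfadj_eigen[OF y assms[OF y]])
  hence "?P dvd R" by (simp add: herm_inner_self vec_minpoly(2)[OF clin, symmetric])
  moreover have "R \<noteq> 0" using P R by auto
  ultimately have "degree ?P \<le> degree R" by (intro dvd_imp_degree_le)
  moreover have "degree ?P = Suc (degree R)"
    unfolding R using \<open>R \<noteq> 0\<close> by (subst degree_mult_eq) auto
  ultimately show False by simp
qed

text \<open>The remainder is orthogonal to every eigenvector: paired with one at \<open>w\<close>,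
  only the summand at \<open>w\<close> survives, and \<open>\<xi> - proj w \<xi>\<close> is
  orthogonal to that eigenspace.\<close>

lemma spectral_decomposition: "\<xi> = (\<Sum>z\<in>op_spectrum A. proj z \<xi>)"
proof -
  have "\<xi> - (\<Sum>z\<in>op_spectrum A. proj z \<xi>) = 0"
  proof (rule orthogonal_to_eigenvectors_eq_0)
    fix w x assume x: "A x = w *s x"
    show "herm_inner (\<xi> - (\<Sum>z\<in>op_spectrum A. proj z \<xi>)) x = 0"
    proof (cases "x = 0")
      case False
      hence w: "w \<in> op_spectrum A" using x by (auto simp: op_spectrum_eq[OF clin] is_eigenvalue_def)
      have "(\<Sum>z\<in>op_spectrum A. herm_inner (proj z \<xi>) x) = (\<Sum>z\<in>{w}. herm_inner (proj z \<xi>) x)"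
        using w eigenvectors_orthogonal[OF proj_eigen x]
        by (intro sum.mono_neutral_right finite_op_spectrum clin) auto
      moreover have "herm_inner (\<xi> - proj w \<xi>) x = 0"
        using orth_proj(2)[OF subspace_eigenspace[OF clin]] x by (simp add: mem_eigenspace_iff)
      ultimately show ?thesis by (simp add: herm_inner_diff herm_inner_sum)
    qed simp
  qed
  thus ?thesis by simp
qed

lemma poly_op_spectral: "poly_op A Q \<xi> = (\<Sum>z\<in>op_spectrum A. poly Q z *s proj z \<xi>)"
proof -
  have "poly_op A Q \<xi> = poly_op A Q (\<Sum>z\<in>op_spectrum A. proj z \<xi>)"
    by (rule arg_cong[OF spectral_decomposition])
  thus ?thesis by (simp only: poly_op_sum_vec[OF clin] poly_op_eigenvector[OF clin proj_eigen])
qed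

section \<open>The support of a vector and its minimal polynomial\<close>

definition support :: "complex ^ 'v \<Rightarrow> complex set" where
  "support \<xi> = {z \<in> op_spectrum A. proj z \<xi> \<noteq> 0}"

lemma finite_support: "finite (support \<xi>)"
  using finite_op_spectrum[OF clin] by (simp add: support_def)

lemma poly_op_eq_0_iff: "poly_op A Q \<xi> = 0 \<longleftrightarrow> (\<forall>z\<in>support \<xi>. poly Q z = 0)"
proof (intro iffI ballI)
  fix w assume Q: "poly_op A Q \<xi> = 0" and w: "w \<in> support \<xi>"
  \<comment> \<open>Pairing with \<open>proj w \<xi>\<close> isolates \<open>poly Q w\<close> times
    a nonzero squared norm.\<close>
  have "herm_inner (poly_op A Q \<xi>) (proj w \<xi>) =
      (\<Sum>z\<in>op_spectrum A. poly Q z * herm_inner (proj z \<xi>) (proj w \<xi>))"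
    by (simp add: poly_op_spectral herm_inner_sum herm_inner_scale)
  also have "\<dots> = (\<Sum>z\<in>{w}. poly Q z * herm_inner (proj z \<xi>) (proj w \<xi>))"
    using w eigenvectors_orthogonal[OF proj_eigen proj_eigen]
    by (intro sum.mono_neutral_right finite_op_spectrum clin) (auto simp: support_def)
  finally show "poly Q w = 0" using Q w by (simp add: support_def herm_inner_self)
next
  assume "\<forall>z\<in>support \<xi>. poly Q z = 0"
  thus "poly_op A Q \<xi> = 0"
    unfolding poly_op_spectral by (intro sum.neutral) (auto simp: support_def)
qed

lemma vec_minpoly_eq: "vec_minpoly A \<xi> = (\<Prod>z\<in>support \<xi>. [:- z, 1:])"
  by (rule vec_minpoly_eqI[OF clin monic_prod_linear])
    (simp add: poly_op_eq_0_iff prod_linear_dvd_iff finite_support)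

lemma op_minpoly_eq: "op_minpoly A = (\<Prod>z\<in>op_spectrum A. [:- z, 1:])"
proof (rule op_minpoly_eqI[OF clin monic_prod_linear])
  fix Q
  \<comment> \<open>\<open>Q(A)\<close> kills all vectors iff \<open>Q\<close> vanishes on the union
    of all supports; eigenvectors make this union the full spectrum.\<close>
  have "(\<Union>\<xi>. support \<xi>) = op_spectrum A"
  proof
    show "op_spectrum A \<subseteq> (\<Union>\<xi>. support \<xi>)"
    proof
      fix z assume z: "z \<in> op_spectrum A"
      then obtain x where "x \<noteq> 0" "A x = z *s x"
        by (auto simp: op_spectrum_eq[OF clin] is_eigenvalue_def)
      with z have "z \<in> support x"
        by (simp add: support_def orth_proj_self subspace_eigenspace clin mem_eigenspace_iff)
      thus "z \<in> (\<Union>\<xi>. support \<xi>)" by blast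
    qed
  qed (auto simp: support_def)
  thus "(\<forall>\<xi>. poly_op A Q \<xi> = 0) \<longleftrightarrow> (\<Prod>z\<in>op_spectrum A. [:- z, 1:]) dvd Q"
    by (auto simp: poly_op_eq_0_iff prod_linear_dvd_iff finite_op_spectrum clin)
qed

lemma vec_minpoly_eq_op_minpoly_iff:
  "vec_minpoly A \<xi> = op_minpoly A \<longleftrightarrow> support \<xi> = op_spectrum A"
proof
  assume "vec_minpoly A \<xi> = op_minpoly A"
  \<comment> \<open>Each set is recovered as the root set of its product.\<close>
  hence "poly (\<Prod>z\<in>support \<xi>. [:- z, 1:]) w = 0 \<longleftrightarrow> poly (\<Prod>z\<in>op_spectrum A. [:- z, 1:]) w = 0" for w
    by (simp add: vec_minpoly_eq op_minpoly_eq)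
  thus "support \<xi> = op_spectrum A"
    by (auto simp: poly_prod_linear_eq_0_iff finite_support finite_op_spectrum clin)
qed (simp add: vec_minpoly_eq op_minpoly_eq)

text \<open>The minimal polynomial has as many linear factors as the support has points, and a
  subset of the finite spectrum reaches its cardinality only by being all of it.\<close>

lemma krylov_independent_iff_support:
  "inj_on (\<lambda>i. (A ^^ i) \<xi>) {..<card (op_spectrum A)} \<and>
    vec.independent ((\<lambda>i. (A ^^ i) \<xi>) ` {..<card (op_spectrum A)}) \<longleftrightarrow>
    support \<xi> = op_spectrum A"
proof -
  have "support \<xi> \<subseteq> op_spectrum A" by (auto simp: support_def)
  hence "card (op_spectrum A) \<le> card (support \<xi>) \<longleftrightarrow> support \<xi> = op_spectrum A"
    using card_seteq finite_op_spectrum[OF clin] by auto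
  thus ?thesis
    by (simp only: krylov_independent_iff_degree[OF clin] vec_minpoly_eq degree_prod_linear)
qed

end

section \<open>The adjacency operator and the equivalences\<close>

lemma hermitian_adjacency_op: "hermitian_op (adjacency_op E)"
proof (unfold hermitian_op_def, intro conjI allI)
  fix x y :: "complex ^ 'a"
  have "herm_inner (adjacency_op E x) y =
      (\<Sum>v\<in>UNIV. \<Sum>w\<in>UNIV. if {v, w} \<in> E then x $ w * cnj (y $ v) else 0)"
    by (simp add: herm_inner_def adjacency_op_def sum_distrib_right sum.If_cases)
  \<comment> \<open>Edges are unordered, so the condition is unchanged when the two sums are
    exchanged.\<close>
  also have "\<dots> = (\<Sum>w\<in>UNIV. \<Sum>v\<in>UNIV. if {w, v} \<in> E then x $ w * cnj (y $ v) else 0)"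
    by (subst sum.swap) (simp add: insert_commute)
  also have "\<dots> = herm_inner x (adjacency_op E y)"
    by (simp add: herm_inner_def adjacency_op_def sum_distrib_left sum.If_cases)
  finally show "herm_inner (adjacency_op E x) y = herm_inner x (adjacency_op E y)" .
qed (rule clin_adjacency_op)

theorem proposition4p4:
  fixes E :: "'v::finite set set"
    and A :: "complex ^ 'v \<Rightarrow> complex ^ 'v"
    and s :: nat
    and lam :: "nat \<Rightarrow> real"
    and c :: "nat \<Rightarrow> real"
    and v :: 'v
  assumes "simple_graph E"
    and "A = adjacency_op E"
    and "strict_antimono_on {1..s} lam"
    and "(\<lambda>j. complex_of_real (lam j)) ` {1..s} = {z. is_eigenvalue A z}"
    and "\<And>j. j \<in> {1..s} \<Longrightarrow>
           c j = norm (orth_proj (eigenspace A (complex_of_real (lam j))) (axis v 1))"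
  shows "op_minpoly A = (\<Prod>j=1..s. [:- complex_of_real (lam j), 1:]) \<and>
    (dominant E v \<longleftrightarrow> vec_minpoly A (axis v 1) = op_minpoly A) \<and>
    (dominant E v \<longleftrightarrow>
       inj_on (\<lambda>i. (A ^^ i) (axis v 1)) {..<s} \<and>
       vec.independent ((\<lambda>i. (A ^^ i) (axis v 1)) ` {..<s})) \<and>
    (dominant E v \<longleftrightarrow>
       (\<forall>j\<in>{1..s}. orth_proj (eigenspace A (complex_of_real (lam j))) (axis v 1) \<noteq> 0)) \<and>
    (dominant E v \<longleftrightarrow> (\<forall>j\<in>{1..s}. (c j)\<^sup>2 > 0)) \<and>
    (dominant E v \<longleftrightarrow>
       (\<forall>z. is_eigenvalue A z \<longrightarrow> measure (local_spectral_measure A (axis v 1)) {z} > 0))"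
proof -
  interpret hermitian_op A unfolding assms(2) by (rule hermitian_adjacency_op)
  let ?lam = "\<lambda>j. complex_of_real (lam j)"
  have spec: "op_spectrum A = ?lam ` {1..s}"
    using assms(4) by (simp add: op_spectrum_eq[OF clin])
  \<comment> \<open>Strict decrease makes the listed eigenvalues distinct, so \<open>s\<close>
    counts the spectrum and products over indices are products over the spectrum.\<close>
  have inj: "inj_on ?lam {1..s}"
  proof (rule linorder_inj_onI')
    fix i j assume "i < j" "i \<in> {1..s}" "j \<in> {1..s}"
    hence "lam j < lam i" using assms(3) by (simp add: monotone_on_def)
    thus "?lam i \<noteq> ?lam j" by simp
  qed
  have card: "card (op_spectrum A) = s" unfolding spec card_image[OF inj] by simp
  have supp: "support \<xi> = op_spectrum A \<longleftrightarrow> (\<forall>z\<in>op_spectrum A. proj z \<xi> \<noteq> 0)" for \<xi>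
    by (auto simp: support_def)
  have dom: "dominant E v \<longleftrightarrow> support (axis v 1) = op_spectrum A"
    unfolding dominant_def supp absolutely_continuous_local_spectral_measure_iff[OF clin]
      assms(2)[symmetric] ..
  have minpoly: "op_minpoly A = (\<Prod>j=1..s. [:- ?lam j, 1:])"
    unfolding op_minpoly_eq spec prod.reindex[OF inj] by simp
  have proj: "dominant E v \<longleftrightarrow> (\<forall>j\<in>{1..s}. proj (?lam j) (axis v 1) \<noteq> 0)"
    unfolding dom supp unfolding spec by blast
  have norm: "dominant E v \<longleftrightarrow> (\<forall>j\<in>{1..s}. (c j)\<^sup>2 > 0)"
    unfolding proj using assms(5) by simp
  have "dominant E v \<longleftrightarrow>
      (\<forall>z\<in>op_spectrum A. measure (local_spectral_measure A (axis v 1)) {z} > 0)"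
    unfolding dom supp by (simp add: measure_local_spectral_measure_singleton[OF clin])
  hence meas: "dominant E v \<longleftrightarrow>
      (\<forall>z. is_eigenvalue A z \<longrightarrow> measure (local_spectral_measure A (axis v 1)) {z} > 0)"
    by (simp add: op_spectrum_eq[OF clin])
  show ?thesis
    using minpoly proj norm meas vec_minpoly_eq_op_minpoly_iff[of "axis v 1"]
      krylov_independent_iff_support[of "axis v 1", unfolded card] dom by argo
qed

end
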